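(* Let $k\ge 2$. Then, as formal power series in $t$ with coefficients in $\mathbb{Q}(p,q,r,x)$, $$\sum_{n\ge 0}\frac{t^n}{[n]_{p,q}!}\sum_{(\sigma,w)\in C_k\wr S_n} q^{\mathrm{inv}(\sigma)}p^{\mathrm{coinv}(\sigma)}r^{\|w\|}x^{\mathrm{sris}(\sigma,w)}=\frac{1-x}{1-x+\sum_{n\ge 1}\frac{p^{\binom{n}{2}}((x-1)t)^n}{[n]_{p,q}!}r^{\binom{n}{2}}\begin{bmatrix} k\\ n\end{bmatrix}_r}.$$
   Context: For $k\ge 2$, $n\ge 0$, the wreath product $C_k\wr S_n$ is identified with the set of pairs $(\sigma,w)$ with $\sigma=\sigma_1\cdots\sigma_n\in S_n$ and $w=w_1\cdots w_n\in\{0,1,\dots,k-1\}^n$ (for $n=0$ there is exactly one, empty, element). $\mathrm{inv}(\sigma)=|\{i<j:\sigma_i>\sigma_j\}|$, $\mathrm{coinv}(\sigma)=|\{i<j:\sigma_i<\sigma_j\}|$, $\|w\|=w_1+\cdots+w_n$. The strict rise statistic is $\mathrm{sris}(\sigma,w)=|\{i\in\{1,\dots,n-1\}:\sigma_i<\sigma_{i+1}\text{ and } w_i< w_{i+1}\}|$. $[n]_{p,q}=\frac{p^n-q^n}{p-q}=p^{n-1}+p^{n-2}q+\cdots+q^{n-1}$, $[n]_{p,q}!=[n]_{p,q}\cdots[1]_{p,q}$ (with $[0]_{p,q}!=1$); $[n]_r=1+r+\cdots+r^{n-1}$, $[n]_r!=[n]_r\cdots[1]_r$, and $\begin{bmatrix}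 a\\ b\end{bmatrix}_r=\frac{[a]_r!}{[b]_r![a-b]_r!}$ for $0\le b\le a$, and $0$ if $b>a$. *)

theory Defs
  imports
    "HOL-Combinatorics.Permutations"
    "HOL-Library.FuncSet"
    "HOL-Computational_Algebra.Polynomial"
    "HOL-Computational_Algebra.Fraction_Field"
    "HOL-Computational_Algebra.Formal_Power_Series"
begin

text \<open>
  Words \<open>w\<close> are extensional functions, so that for each \<open>n\<close> there are exactly \<open>k ^ n\<close> of them.
\<close>

definition wreath :: "nat \<Rightarrow> nat \<Rightarrow> ((nat \<Rightarrow> nat) \<times> (nat \<Rightarrow> nat)) set" where
  "wreath k n = {\<sigma>. \<sigma> permutes {1..n}} \<times> ({1..n} \<rightarrow>\<^sub>E {0..<k})"

definition perm_inv :: "nat \<Rightarrow> (nat \<Rightarrow> nat) \<Rightarrow> nat" where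
  "perm_inv n \<sigma> = card {(i, j). i \<in> {1..n} \<and> j \<in> {1..n} \<and> i < j \<and> \<sigma> i > \<sigma> j}"

definition perm_coinv :: "nat \<Rightarrow> (nat \<Rightarrow> nat) \<Rightarrow> nat" where
  "perm_coinv n \<sigma> = card {(i, j). i \<in> {1..n} \<and> j \<in> {1..n} \<and> i < j \<and> \<sigma> i < \<sigma> j}"

definition word_weight :: "nat \<Rightarrow> (nat \<Rightarrow> nat) \<Rightarrow> nat" where
  "word_weight n w = (\<Sum>i = 1..n. w i)"

definition sris :: "nat \<Rightarrow> (nat \<Rightarrow> nat) \<Rightarrow> (nat \<Rightarrow> nat) \<Rightarrow> nat" where
  "sris n \<sigma> w = card {i \<in> {1..<n}. \<sigma> i < \<sigma> (i + 1) \<and> w i < w (i + 1)}"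

definition pq_num :: "'a::field \<Rightarrow> 'a \<Rightarrow> nat \<Rightarrow> 'a" where
  "pq_num p q n = (\<Sum>i<n. p ^ (n - 1 - i) * q ^ i)"

definition pq_fact :: "'a::field \<Rightarrow> 'a \<Rightarrow> nat \<Rightarrow> 'a" where
  "pq_fact p q n = (\<Prod>i = 1..n. pq_num p q i)"

definition r_num :: "'a::field \<Rightarrow> nat \<Rightarrow> 'a" where
  "r_num r n = (\<Sum>i<n. r ^ i)"

definition r_fact :: "'a::field \<Rightarrow> nat \<Rightarrow> 'a" where
  "r_fact r n = (\<Prod>i = 1..n. r_num r i)"

definition r_binom :: "'a::field \<Rightarrow> nat \<Rightarrow> nat \<Rightarrow> 'a" where
  "r_binom r a b = (if b \<le> a then r_fact r a / (r_fact r b * r_fact r (a - b)) else 0)"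

text \<open>
  The field \<open>\<rat>(p, q, r, x)\<close> is the fraction field of \<open>\<rat>[p][q][r][x]\<close>; the indeterminate \<open>p\<close> lives
  at the innermost polynomial layer and \<open>x\<close> at the outermost one.
\<close>

type_synonym ratfun = "rat poly poly poly poly fract"

definition var_p :: ratfun where
  "var_p = Fract [:[:[:[:0, 1:]:]:]:] 1"

definition var_q :: ratfun where
  "var_q = Fract [:[:[:0, 1:]:]:] 1"

definition var_r :: ratfun where
  "var_r = Fract [:[:0, 1:]:] 1"

definition var_x :: ratfun where
  "var_x = Fract [:0, 1:] 1"

definition sris_gf :: "'a::field \<Rightarrow> 'a \<Rightarrow> 'a \<Rightarrow> 'a \<Rightarrow> nat \<Rightarrow> 'a fps" where
  "sris_gf p q r x k = Abs_fps (\<lambda>n. (1 / pq_fact p q n) *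
     (\<Sum>(\<sigma>, w)\<in>wreath k n.
        q ^ perm_inv n \<sigma> * p ^ perm_coinv n \<sigma> * r ^ word_weight n w * x ^ sris n \<sigma> w))"

text \<open>
  The sum over \<open>n \<ge> 1\<close> in the denominator, with \<open>((x - 1) t)\<^sup>n\<close> split into its coefficient
  \<open>(x - 1)\<^sup>n\<close> and the power \<open>t\<^sup>n\<close>.
\<close>

definition sris_denom_sum :: "'a::field \<Rightarrow> 'a \<Rightarrow> 'a \<Rightarrow> 'a \<Rightarrow> nat \<Rightarrow> 'a fps" where
  "sris_denom_sum p q r x k = Abs_fps (\<lambda>n. if n = 0 then 0 else
     p ^ (n choose 2) * (x - 1) ^ n / pq_fact p q n * r ^ (n choose 2) * r_binom r k n)"

end

theory Submission
  imports Defs "HOL-Computational_Algebra.Polynomial_Factorial"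
begin

text \<open>
  The Lehmer code turns a permutation into a word \<open>v\<close> with \<open>v\<^sub>i < i\<close> that has the same rises and whose
  letters carry the inversions and coinversions independently of each other. Pairs \<open>(\<sigma>, w)\<close> thus
  become words in the letters \<open>(v\<^sub>i, w\<^sub>i)\<close> weighted by a product over positions and by \<open>x\<close> to the number
  of rises. Writing \<open>x = 1 + (x - 1)\<close> at each rise and splitting off the final chain of marked rises
  gives a convolution recurrence. The weight of all chains of \<open>m\<close> letters factors into a sum over
  strictly increasing \<open>v\<close> and one over strictly increasing \<open>w\<close>; both are Gaussian binomial
  coefficients by the same hockey-stick identity, the second with \<open>(p, q) = (r, 1)\<close>. The recurrence is
  the coefficientwise form of the theorem.
\<close>

section \<open>Gaussian binomial coefficients in two parameters\<close>

text \<open>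
  Defined by Pascal's rule rather than as a quotient of factorials, so that no \<open>pq_num p q i\<close> has to
  be nonzero.
\<close>

fun pq_binom :: "'a::comm_semiring_1 \<Rightarrow> 'a \<Rightarrow> nat \<Rightarrow> nat \<Rightarrow> 'a" where
  "pq_binom p q n 0 = 1"
| "pq_binom p q 0 (Suc m) = 0"
| "pq_binom p q (Suc n) (Suc m) =
    q ^ Suc m * pq_binom p q n (Suc m) + p ^ (n - m) * pq_binom p q n m"

lemma pq_binom_eq_0: "n < m \<Longrightarrow> pq_binom p q n m = 0"
  by (induction p q n m rule: pq_binom.induct) auto

lemma pq_binom_self [simp]: "pq_binom p q n n = 1"
  by (induction n) (simp_all add: pq_binom_eq_0)

lemma Suc_choose_two: "Suc m choose 2 = (m choose 2) + m"
  by (simp add: numeral_2_eq_2)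

lemma pq_binom_hockey_stick:
  "p ^ (Suc m choose 2) * pq_binom p q n (Suc m) =
    (\<Sum>v<n. q ^ (Suc m * (n - 1 - v)) * p ^ v * (p ^ (m choose 2) * pq_binom p q v m))"
proof (induction n)
  case 0
  show ?case by simp
next
  case (Suc n)
  have q_power_shift: "q ^ (Suc m * (n - v)) = q ^ Suc m * q ^ (Suc m * (n - 1 - v))" if "v < n" for v
  proof -
    have "n - v = Suc (n - 1 - v)" using that by simp
    then show ?thesis by (simp only: mult_Suc_right power_add)
  qed
  have last_term: "p ^ (Suc m choose 2) * (p ^ (n - m) * pq_binom p q n m) =
      p ^ n * (p ^ (m choose 2) * pq_binom p q n m)"
    by (cases "m \<le> n")
      (simp_all add: Suc_choose_two pq_binom_eq_0 add.commute flip: power_add mult.assoc)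
  have "p ^ (Suc m choose 2) * pq_binom p q (Suc n) (Suc m) =
      q ^ Suc m * (p ^ (Suc m choose 2) * pq_binom p q n (Suc m)) +
      p ^ n * (p ^ (m choose 2) * pq_binom p q n m)"
    unfolding last_term [symmetric] by (simp only: pq_binom.simps distrib_left mult.left_commute)
  also have "\<dots> = (\<Sum>v<n. q ^ (Suc m * (n - v)) * p ^ v * (p ^ (m choose 2) * pq_binom p q v m)) +
      p ^ n * (p ^ (m choose 2) * pq_binom p q n m)"
    by (simp add: Suc.IH sum_distrib_left q_power_shift mult.assoc del: power_Suc mult_Suc)
  finally show ?case by simp
qed

lemma pq_num_Suc: "pq_num p q (Suc n) = p * pq_num p q n + q ^ n"
proof -
  have "(\<Sum>i<n. p ^ (n - i) * q ^ i) = (\<Sum>i<n. p * (p ^ (n - 1 - i) * q ^ i))"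
    by (intro sum.cong refl) (simp add: Suc_diff_Suc flip: mult.assoc power_Suc)
  then show ?thesis by (simp add: pq_num_def sum_distrib_left)
qed

lemma pq_num_add: "pq_num p q (a + b) = p ^ a * pq_num p q b + q ^ b * pq_num p q a"
proof (induction a)
  case 0
  show ?case by (simp add: pq_num_def)
next
  case (Suc a)
  then show ?case by (simp add: pq_num_Suc algebra_simps power_add)
qed

lemma pq_fact_0 [simp]: "pq_fact p q 0 = 1"
  by (simp add: pq_fact_def)

lemma pq_fact_Suc: "pq_fact p q (Suc n) = pq_num p q (Suc n) * pq_fact p q n"
  by (simp add: pq_fact_def mult.commute)

lemma pq_binom_fact_lemma:
  "pq_fact p q m * pq_fact p q d * pq_binom p q (m + d) m = pq_fact p q (m + d)"
proof (induction m arbitrary: d)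
  case 0
  show ?case by simp
next
  case (Suc m)
  note IH_m = Suc.IH
  show ?case
  proof (induction d)
    case 0
    show ?case by simp
  next
    case (Suc d)
    let ?N = "pq_num p q" and ?F = "pq_fact p q"
    have pascal: "pq_binom p q (Suc m + Suc d) (Suc m) =
        q ^ Suc m * pq_binom p q (Suc m + d) (Suc m) + p ^ Suc d * pq_binom p q (m + Suc d) m"
      by simp
    have "?F (Suc m) * ?F (Suc d) * pq_binom p q (Suc m + Suc d) (Suc m) =
        q ^ Suc m * ?N (Suc d) * (?F (Suc m) * ?F d * pq_binom p q (Suc m + d) (Suc m)) +
        p ^ Suc d * ?N (Suc m) * (?F m * ?F (Suc d) * pq_binom p q (m + Suc d) m)"
      unfolding pascal pq_fact_Suc [of p q m] pq_fact_Suc [of p q d]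
      by (simp only: distrib_left mult_ac)
    also have "\<dots> = (p ^ Suc d * ?N (Suc m) + q ^ Suc m * ?N (Suc d)) * ?F (Suc m + d)"
      unfolding Suc.IH IH_m by (simp add: distrib_right del: power_Suc)
    also have "\<dots> = ?N (Suc d + Suc m) * ?F (Suc m + d)"
      by (simp only: pq_num_add)
    also have "\<dots> = ?F (Suc m + Suc d)"
      using pq_fact_Suc [of p q "Suc m + d"] by (simp add: add.commute)
    finally show ?case .
  qed
qed

lemma pq_binom_div_pq_fact:
  assumes "\<And>i. pq_fact p q i \<noteq> 0" and "m \<le> n"
  shows "pq_binom p q n m / pq_fact p q n = 1 / (pq_fact p q m * pq_fact p q (n - m))"
  using pq_binom_fact_lemma [of p q m "n - m"] assms by (simp add: frac_eq_eq mult.commute)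

lemma r_num_eq_pq_num: "r_num r n = pq_num r 1 n"
  unfolding r_num_def pq_num_def by (subst sum.nat_diff_reindex [symmetric]) simp

lemma r_fact_eq_pq_fact: "r_fact r n = pq_fact r 1 n"
  by (simp add: r_fact_def pq_fact_def r_num_eq_pq_num)

lemma r_binom_eq_pq_binom:
  assumes "r_fact r a \<noteq> 0"
  shows "r_binom r a b = pq_binom r 1 a b"
proof (cases "b \<le> a")
  case True
  then have "r_fact r b * r_fact r (a - b) * pq_binom r 1 a b = r_fact r a"
    using pq_binom_fact_lemma [of r 1 b "a - b"] by (simp add: r_fact_eq_pq_fact)
  then have "r_fact r a / (r_fact r b * r_fact r (a - b)) = pq_binom r 1 a b"
    using assms by (metis mult_zero_left nonzero_mult_div_cancel_left)
  with True show ?thesis by (simp add: r_binom_def)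
next
  case False
  then show ?thesis by (simp add: r_binom_def pq_binom_eq_0)
qed

section \<open>Words weighted by their rises\<close>

lemma sum_PiE_insert:
  assumes "i \<notin> I"
  shows "(\<Sum>u\<in>Pi\<^sub>E (insert i I) X. f u) = (\<Sum>b\<in>X i. \<Sum>u\<in>Pi\<^sub>E I X. f (u(i := b)))"
proof -
  have "(\<Sum>u\<in>Pi\<^sub>E (insert i I) X. f u) = (\<Sum>(b, u)\<in>X i \<times> Pi\<^sub>E I X. f (u(i := b)))"
    unfolding PiE_insert_eq
    by (subst sum.reindex [OF inj_combinator [OF assms]]) (simp add: case_prod_beta)
  then show ?thesis by (simp add: sum.cartesian_product)
qed

context
  fixes X :: "nat \<Rightarrow> 'u set" and c :: "nat \<Rightarrow> 'u \<Rightarrow> 'a::comm_ring_1"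
    and R :: "'u \<Rightarrow> 'u \<Rightarrow> bool" and x :: 'a
begin

definition rises :: "nat \<Rightarrow> (nat \<Rightarrow> 'u) \<Rightarrow> nat" where
  "rises n u = card {i \<in> {1..<n}. R (u i) (u (i + 1))}"

definition word_sum :: "nat \<Rightarrow> 'a" where
  "word_sum n = (\<Sum>u\<in>Pi\<^sub>E {1..n} X. (\<Prod>i=1..n. c i (u i)) * x ^ rises n u)"

definition word_sum_to :: "nat \<Rightarrow> 'u \<Rightarrow> 'a" where
  "word_sum_to n a =
    (\<Sum>u\<in>Pi\<^sub>E {1..n} X. (\<Prod>i=1..n. c i (u i)) * x ^ rises (Suc n) (u(Suc n := a)))"

text \<open>
  Sums over the chains \<open>u\<^sub>M\<^sub>+\<^sub>1, \<dots>, u\<^sub>M\<^sub>+\<^sub>m\<close> all of whose steps, including the one from the last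
  letter to \<open>a\<close>, are rises.
\<close>

fun chain_sum :: "nat \<Rightarrow> nat \<Rightarrow> 'u \<Rightarrow> 'a" where
  "chain_sum M 0 a = 1"
| "chain_sum M (Suc m) a =
    (\<Sum>b | b \<in> X (Suc (M + m)) \<and> R b a. c (Suc (M + m)) b * chain_sum M m b)"

lemma rises_fun_upd_Suc:
  "rises (Suc n) (u(Suc n := b)) = rises n u + of_bool (n \<ge> 1 \<and> R (u n) b)"
proof -
  let ?A = "{i \<in> {1..<n}. R (u i) (u (i + 1))}"
  have "{i \<in> {1..<Suc n}. R ((u(Suc n := b)) i) ((u(Suc n := b)) (i + 1))} =
      (if n \<ge> 1 \<and> R (u n) b then insert n ?A else ?A)"
    by (auto simp: less_Suc_eq)
  then show ?thesis by (simp add: rises_def)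
qed

lemma sum_words_Suc:
  "(\<Sum>u\<in>Pi\<^sub>E {1..Suc n} X. (\<Prod>i=1..Suc n. c i (u i)) * f u) =
    (\<Sum>b\<in>X (Suc n). c (Suc n) b *
      (\<Sum>u\<in>Pi\<^sub>E {1..n} X. (\<Prod>i=1..n. c i (u i)) * f (u(Suc n := b))))"
proof -
  have "(\<Prod>i=1..Suc n. c i ((u(Suc n := b)) i)) = c (Suc n) b * (\<Prod>i=1..n. c i (u i))" for u b
    by (simp add: mult.commute)
  then show ?thesis
    by (simp add: atLeastAtMostSuc_conv sum_PiE_insert sum_distrib_left mult.assoc)
qed

lemma word_sum_0 [simp]: "word_sum 0 = 1"
  by (simp add: word_sum_def rises_def)

lemma word_sum_Suc: "word_sum (Suc n) = (\<Sum>b\<in>X (Suc n). c (Suc n) b * word_sum_to n b)"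
  unfolding word_sum_def word_sum_to_def by (rule sum_words_Suc)

lemma word_sum_to_0 [simp]: "word_sum_to 0 a = 1"
  by (simp add: word_sum_to_def rises_def)

lemma word_sum_to_Suc:
  assumes "finite (X (Suc n))"
  shows "word_sum_to (Suc n) a = word_sum (Suc n) +
    (x - 1) * (\<Sum>b | b \<in> X (Suc n) \<and> R b a. c (Suc n) b * word_sum_to n b)"
proof -
  have "word_sum_to (Suc n) a =
      (\<Sum>b\<in>X (Suc n). c (Suc n) b * (word_sum_to n b * x ^ of_bool (R b a)))"
    unfolding word_sum_to_def [of "Suc n"] sum_words_Suc
    unfolding word_sum_to_def rises_fun_upd_Suc [of "Suc n"]
    by (simp add: power_add sum_distrib_right mult.assoc)
  also have "\<dots> = (\<Sum>b\<in>X (Suc n). c (Suc n) b * word_sum_to n b +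
      (x - 1) * (if R b a then c (Suc n) b * word_sum_to n b else 0))"
    by (intro sum.cong refl) (simp add: algebra_simps)
  also have "\<dots> = word_sum (Suc n) +
      (x - 1) * (\<Sum>b | b \<in> X (Suc n) \<and> R b a. c (Suc n) b * word_sum_to n b)"
    by (simp add: sum.distrib word_sum_Suc sum.inter_filter [OF assms] flip: sum_distrib_left)
  finally show ?thesis .
qed

lemma word_sum_to_eq_sum_chain_sum:
  assumes "\<And>i. finite (X i)"
  shows "word_sum_to n a = (\<Sum>m\<le>n. (x - 1) ^ m * word_sum (n - m) * chain_sum (n - m) m a)"
proof (induction n arbitrary: a)
  case 0
  show ?case by simp
next
  case (Suc n)
  let ?Y = "{b. b \<in> X (Suc n) \<and> R b a}"
  have "(\<Sum>b\<in>?Y. c (Suc n) b * word_sum_to n b) =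
      (\<Sum>b\<in>?Y. \<Sum>m\<le>n. (x - 1) ^ m * word_sum (n - m) * (c (Suc n) b * chain_sum (n - m) m b))"
    unfolding Suc.IH by (simp add: sum_distrib_left mult_ac)
  also have "\<dots> = (\<Sum>m\<le>n. (x - 1) ^ m * word_sum (n - m) * chain_sum (n - m) (Suc m) a)"
    by (subst sum.swap) (simp add: sum_distrib_left)
  finally have "word_sum_to (Suc n) a = word_sum (Suc n) +
      (x - 1) * (\<Sum>m\<le>n. (x - 1) ^ m * word_sum (n - m) * chain_sum (n - m) (Suc m) a)"
    by (simp only: word_sum_to_Suc [OF assms])
  also have "\<dots> = (\<Sum>m\<le>Suc n. (x - 1) ^ m * word_sum (Suc n - m) * chain_sum (Suc n - m) m a)"
    by (subst sum.atMost_Suc_shift) (simp add: sum_distrib_left mult_ac del: chain_sum.simps(2))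
  finally show ?case .
qed

lemma word_sum_Suc_eq_sum_chain_sum:
  assumes "\<And>i. finite (X i)" and top: "\<And>b. b \<in> X (Suc n) \<Longrightarrow> R b a"
  shows "word_sum (Suc n) =
    (\<Sum>m\<le>n. (x - 1) ^ m * word_sum (n - m) * chain_sum (n - m) (Suc m) a)"
proof -
  have below_top: "{b. b \<in> X (Suc n) \<and> R b a} = X (Suc n)" using top by auto
  show ?thesis
    unfolding word_sum_Suc word_sum_to_eq_sum_chain_sum [OF assms(1)] sum_distrib_left
    by (subst sum.swap) (simp add: below_top sum_distrib_left mult_ac)
qed

end

lemma chain_sum_Times:
  "chain_sum (\<lambda>i. A i \<times> B i) (\<lambda>i (a, b). f i a * g i b) (rel_prod R S) M m (a, b) =
    chain_sum A f R M m a * chain_sum B g S M m b"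
proof (induction m arbitrary: a b)
  case 0
  show ?case by simp
next
  case (Suc m)
  let ?i = "Suc (M + m)"
  have "{z. z \<in> A ?i \<times> B ?i \<and> rel_prod R S z (a, b)} =
      {a'. a' \<in> A ?i \<and> R a' a} \<times> {b'. b' \<in> B ?i \<and> S b' b}"
    by auto
  then show ?case
    by (simp add: sum_product sum.cartesian_product)
      (intro sum.cong refl, auto simp: Suc.IH mult_ac)
qed

section \<open>Lehmer codes\<close>

definition lehmer_code :: "(nat \<Rightarrow> 'b::linorder) \<Rightarrow> nat \<Rightarrow> nat" where
  "lehmer_code \<sigma> i = card {j \<in> {1..<i}. \<sigma> j < \<sigma> i}"

lemma lehmer_code_less:
  assumes "i \<ge> 1"
  shows "lehmer_code \<sigma> i < i"
proof -
  have "lehmer_code \<sigma> i \<le> card {1..<i}" unfolding lehmer_code_def by (rule card_mono) auto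
  with assms show ?thesis by simp
qed

lemma lehmer_code_less_Suc_iff:
  assumes "inj_on \<sigma> {1..n}" and "i \<in> {1..<n}"
  shows "lehmer_code \<sigma> i < lehmer_code \<sigma> (i + 1) \<longleftrightarrow> \<sigma> i < \<sigma> (i + 1)"
proof (cases "\<sigma> i < \<sigma> (i + 1)")
  case True
  have "lehmer_code \<sigma> i < lehmer_code \<sigma> (i + 1)"
    unfolding lehmer_code_def
  proof (rule psubset_card_mono)
    show "{j \<in> {1..<i}. \<sigma> j < \<sigma> i} \<subset> {j \<in> {1..<i + 1}. \<sigma> j < \<sigma> (i + 1)}"
      using True assms(2) by (intro psubsetI) (auto simp: set_eq_iff)
  qed simp
  with True show ?thesis by simp
next
  case False
  have "\<sigma> i \<noteq> \<sigma> (i + 1)" using assms by (auto dest: inj_onD)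
  with False have "lehmer_code \<sigma> (i + 1) \<le> lehmer_code \<sigma> i"
    unfolding lehmer_code_def by (intro card_mono) (auto simp: less_Suc_eq)
  with False show ?thesis by simp
qed

lemma card_pairs_less:
  "card {(i, j). i \<in> {1..n} \<and> j \<in> {1..n} \<and> i < j \<and> P i j} =
    (\<Sum>j=1..n. card {i \<in> {1..<j::nat}. P i j})"
proof -
  have "{(i, j). i \<in> {1..n} \<and> j \<in> {1..n} \<and> i < j \<and> P i j} =
      prod.swap ` (SIGMA j:{1..n}. {i \<in> {1..<j}. P i j})"
    by (auto simp: image_iff)
  then show ?thesis by (simp add: card_image)
qed

lemma perm_coinv_eq_sum_lehmer_code: "perm_coinv n \<sigma> = (\<Sum>i=1..n. lehmer_code \<sigma> i)"
  unfolding perm_coinv_def lehmer_code_def card_pairs_less ..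

lemma perm_inv_eq_sum_lehmer_code:
  assumes "inj_on \<sigma> {1..n}"
  shows "perm_inv n \<sigma> = (\<Sum>i=1..n. i - 1 - lehmer_code \<sigma> i)"
  unfolding perm_inv_def card_pairs_less
proof (intro sum.cong refl)
  fix j assume "j \<in> {1..n}"
  then have "\<sigma> i \<noteq> \<sigma> j" if "i \<in> {1..<j}" for i
    using that inj_onD [OF assms, of i j] by auto
  then have "\<sigma> j < \<sigma> i \<longleftrightarrow> \<not> \<sigma> i < \<sigma> j" if "i \<in> {1..<j}" for i
    using that by (metis linorder_neqE order.asym)
  then have "{i \<in> {1..<j}. \<sigma> j < \<sigma> i} = {1..<j} - {i \<in> {1..<j}. \<sigma> i < \<sigma> j}" by blast
  moreover have "card ({1..<j} - {i \<in> {1..<j}. \<sigma> i < \<sigma> j}) = card {1..<j} - lehmer_code \<sigma> j"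
    unfolding lehmer_code_def by (rule card_Diff_subset) auto
  ultimately show "card {i \<in> {1..<j}. \<sigma> j < \<sigma> i} = j - 1 - lehmer_code \<sigma> j"
    by simp
qed

lemma inj_on_card_less:
  fixes S :: "'b::linorder set"
  assumes "finite S"
  shows "inj_on (\<lambda>a. card {y \<in> S. y < a}) S"
proof (rule linorder_inj_onI)
  fix a b assume "a < b" "a \<in> S"
  then have "card {y \<in> S. y < a} < card {y \<in> S. y < b}"
    using assms by (intro psubset_card_mono psubsetI) (auto simp: set_eq_iff)
  then show "card {y \<in> S. y < a} \<noteq> card {y \<in> S. y < b}" by simp
qed auto

lemma lehmer_code_eq_card_image:
  assumes "inj_on \<sigma> {1..i}"
  shows "lehmer_code \<sigma> i = card {y \<in> \<sigma> ` {1..i}. y < \<sigma> i}"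
proof -
  have "{y \<in> \<sigma> ` {1..i}. y < \<sigma> i} = \<sigma> ` {j \<in> {1..<i}. \<sigma> j < \<sigma> i}"
    by (auto simp: less_le)
  moreover have "inj_on \<sigma> {j \<in> {1..<i}. \<sigma> j < \<sigma> i}"
    by (rule inj_on_subset [OF assms]) auto
  ultimately show ?thesis by (simp add: lehmer_code_def card_image)
qed

text \<open>
  Read from the right, the code gives the rank of \<open>\<sigma> i\<close> in \<open>\<sigma> ` {1..i}\<close>, which is the set of values
  that the positions further right leave over.
\<close>

lemma lehmer_code_inject:
  assumes "inj_on \<sigma> {1..n}" and "inj_on \<tau> {1..n}" and "\<sigma> ` {1..n} = \<tau> ` {1..n}"
    and "\<And>i. i \<in> {1..n} \<Longrightarrow> lehmer_code \<sigma> i = lehmer_code \<tau> i"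
  shows "\<forall>i\<in>{1..n}. \<sigma> i = \<tau> i"
  using assms
proof (induction n)
  case 0
  show ?case by simp
next
  case (Suc n)
  let ?S = "\<sigma> ` {1..Suc n}"
  have "card {y \<in> ?S. y < \<sigma> (Suc n)} = card {y \<in> ?S. y < \<tau> (Suc n)}"
    using Suc.prems(4) [of "Suc n"]
    unfolding lehmer_code_eq_card_image [OF Suc.prems(1)]
      lehmer_code_eq_card_image [OF Suc.prems(2)] Suc.prems(3) by simp
  moreover have "\<tau> (Suc n) \<in> ?S" unfolding Suc.prems(3) by simp
  ultimately have last_eq: "\<sigma> (Suc n) = \<tau> (Suc n)"
    by (intro inj_onD [OF inj_on_card_less [of ?S]]) simp_all
  have image_init: "\<pi> ` {1..n} = \<pi> ` {1..Suc n} - {\<pi> (Suc n)}"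
    if "inj_on \<pi> {1..Suc n}" for \<pi> :: "nat \<Rightarrow> 'a"
    using that by (auto simp: atLeastAtMostSuc_conv)
  have "\<sigma> ` {1..n} = \<tau> ` {1..n}"
    unfolding image_init [OF Suc.prems(1)] image_init [OF Suc.prems(2)] Suc.prems(3) last_eq ..
  then have "\<forall>i\<in>{1..n}. \<sigma> i = \<tau> i"
    using Suc.prems by (intro Suc.IH) (auto intro: inj_on_subset)
  with last_eq show ?case by (simp add: atLeastAtMostSuc_conv)
qed

lemma bij_betw_lehmer_code:
  "bij_betw (\<lambda>\<sigma>. \<lambda>i\<in>{1..n}. lehmer_code \<sigma> i) {\<sigma>. \<sigma> permutes {1..n}} (\<Pi>\<^sub>E i\<in>{1..n}. {..<i})"
    (is "bij_betw ?code ?P ?V")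
proof -
  have inj: "inj_on ?code ?P"
  proof (rule inj_onI)
    fix \<sigma> \<tau> assume perms: "\<sigma> \<in> ?P" "\<tau> \<in> ?P" and "?code \<sigma> = ?code \<tau>"
    then have "lehmer_code \<sigma> i = lehmer_code \<tau> i" if "i \<in> {1..n}" for i
      using that by (metis restrict_apply')
    then have "\<forall>i\<in>{1..n}. \<sigma> i = \<tau> i"
      using perms by (intro lehmer_code_inject) (auto simp: permutes_inj_on permutes_image)
    with perms show "\<sigma> = \<tau>" by (metis ext mem_Collect_eq permutes_not_in)
  qed
  have "?code ` ?P = ?V"
  proof (rule card_subset_eq)
    show "finite ?V" by (intro finite_PiE) auto
    show "?code ` ?P \<subseteq> ?V" by (auto simp: lehmer_code_less)
    show "card (?code ` ?P) = card ?V"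
      unfolding card_image [OF inj] by (simp add: card_permutations [of _ n] card_PiE fact_prod)
  qed
  with inj show ?thesis by (simp add: bij_betw_def)
qed

lemma bij_betw_PiE_Times:
  "bij_betw (\<lambda>(f, g). \<lambda>i\<in>I. (f i, g i)) (Pi\<^sub>E I A \<times> Pi\<^sub>E I B) (\<Pi>\<^sub>E i\<in>I. A i \<times> B i)"
  by (rule bij_betw_byWitness [where f' = "\<lambda>h. (\<lambda>i\<in>I. fst (h i), \<lambda>i\<in>I. snd (h i))"])
    (auto simp: PiE_iff extensional_def fun_eq_iff mem_Times_iff)

definition wreath_code :: "nat \<Rightarrow> (nat \<Rightarrow> nat) \<times> (nat \<Rightarrow> nat) \<Rightarrow> nat \<Rightarrow> nat \<times> nat" where
  "wreath_code n = (\<lambda>(\<sigma>, w). \<lambda>i\<in>{1..n}. (lehmer_code \<sigma> i, w i))"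

lemma bij_betw_wreath_code:
  "bij_betw (wreath_code n) (wreath k n) (\<Pi>\<^sub>E i\<in>{1..n}. {..<i} \<times> {..<k})"
proof -
  have "wreath_code n = (\<lambda>(v, w). \<lambda>i\<in>{1..n}. (v i, w i)) \<circ>
      map_prod (\<lambda>\<sigma>. \<lambda>i\<in>{1..n}. lehmer_code \<sigma> i) id"
    by (auto simp: wreath_code_def fun_eq_iff)
  then show ?thesis
    unfolding wreath_def atLeast0LessThan
    by (simp only:) (rule bij_betw_trans [OF
        bij_betw_map_prod [OF bij_betw_lehmer_code bij_betw_id] bij_betw_PiE_Times])
qed

section \<open>The generating function\<close>

definition sris_poly :: "'a::comm_ring_1 \<Rightarrow> 'a \<Rightarrow> 'a \<Rightarrow> 'a \<Rightarrow> nat \<Rightarrow> nat \<Rightarrow> 'a" where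
  "sris_poly p q r x k n = (\<Sum>(\<sigma>, w)\<in>wreath k n.
     q ^ perm_inv n \<sigma> * p ^ perm_coinv n \<sigma> * r ^ word_weight n w * x ^ sris n \<sigma> w)"

abbreviation code_weight :: "'a::comm_ring_1 \<Rightarrow> 'a \<Rightarrow> nat \<Rightarrow> nat \<Rightarrow> 'a" where
  "code_weight p q i v \<equiv> q ^ (i - 1 - v) * p ^ v"

abbreviation wreath_letters :: "nat \<Rightarrow> nat \<Rightarrow> (nat \<times> nat) set" where
  "wreath_letters k i \<equiv> {..<i} \<times> {..<k}"

abbreviation wreath_weight :: "'a::comm_ring_1 \<Rightarrow> 'a \<Rightarrow> 'a \<Rightarrow> nat \<Rightarrow> nat \<times> nat \<Rightarrow> 'a" where
  "wreath_weight p q r i \<equiv> (\<lambda>(v, w). code_weight p q i v * r ^ w)"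

lemma prod_wreath_weight:
  assumes "inj_on \<sigma> {1..n}"
  shows "(\<Prod>i=1..n. wreath_weight p q r i (wreath_code n (\<sigma>, w) i)) =
    q ^ perm_inv n \<sigma> * p ^ perm_coinv n \<sigma> * r ^ word_weight n w"
proof -
  have "(\<Prod>i=1..n. wreath_weight p q r i (wreath_code n (\<sigma>, w) i)) =
      (\<Prod>i=1..n. code_weight p q i (lehmer_code \<sigma> i) * r ^ w i)"
    by (intro prod.cong refl) (simp add: wreath_code_def)
  then show ?thesis
    by (simp add: prod.distrib power_sum word_weight_def perm_coinv_eq_sum_lehmer_code
        perm_inv_eq_sum_lehmer_code [OF assms])
qed

lemma rises_wreath_code:
  assumes "inj_on \<sigma> {1..n}"
  shows "rises (rel_prod (<) (<)) n (wreath_code n (\<sigma>, w)) = sris n \<sigma> w"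
  unfolding rises_def sris_def
  using lehmer_code_less_Suc_iff [OF assms]
  by (intro arg_cong [of _ _ card] Collect_cong) (auto simp: wreath_code_def)

lemma sris_poly_eq_word_sum:
  "sris_poly p q r x k n =
    word_sum (wreath_letters k) (wreath_weight p q r) (rel_prod (<) (<)) x n"
  unfolding sris_poly_def word_sum_def
    sum.reindex_bij_betw [OF bij_betw_wreath_code [of n k], symmetric]
proof (intro sum.cong refl, clarify)
  fix \<sigma> w assume "(\<sigma>, w) \<in> wreath k n"
  then have "inj_on \<sigma> {1..n}" by (auto simp: wreath_def permutes_inj_on)
  then show "q ^ perm_inv n \<sigma> * p ^ perm_coinv n \<sigma> * r ^ word_weight n w * x ^ sris n \<sigma> w =
      (\<Prod>i=1..n. wreath_weight p q r i (wreath_code n (\<sigma>, w) i)) *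
      x ^ rises (rel_prod (<) (<)) n (wreath_code n (\<sigma>, w))"
    by (simp only: prod_wreath_weight rises_wreath_code)
qed

lemma chain_sum_code_weight:
  assumes "v \<le> M + m"
  shows "chain_sum (\<lambda>i. {..<i}) (code_weight p q) (<) M m v =
    q ^ (m * (M + m - v)) * (p ^ (m choose 2) * pq_binom p q v m)"
  using assms
proof (induction m arbitrary: v)
  case 0
  show ?case by (simp add: numeral_2_eq_2)
next
  case (Suc m)
  have below: "{b. b \<in> {..<Suc (M + m)} \<and> b < v} = {..<v}" using Suc.prems by auto
  have q_powers: "q ^ (M + m - b) * q ^ (m * (M + m - b)) =
      q ^ (Suc m * (M + Suc m - v)) * q ^ (Suc m * (v - 1 - b))" if "b < v" for b
  proof -
    have "M + m - b = (M + Suc m - v) + (v - 1 - b)" using that Suc.prems by simp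
    then show ?thesis by (simp only: mult_Suc power_add distrib_left) (simp add: mult_ac)
  qed
  have "chain_sum (\<lambda>i. {..<i}) (code_weight p q) (<) M (Suc m) v =
      (\<Sum>b<v. q ^ (M + m - b) * q ^ (m * (M + m - b)) *
        (p ^ b * (p ^ (m choose 2) * pq_binom p q b m)))"
    using Suc by (simp only: chain_sum.simps below) (simp add: mult_ac)
  also have "\<dots> = q ^ (Suc m * (M + Suc m - v)) *
      (\<Sum>b<v. q ^ (Suc m * (v - 1 - b)) * p ^ b * (p ^ (m choose 2) * pq_binom p q b m))"
    by (simp add: q_powers sum_distrib_left mult.assoc del: mult_Suc)
  finally show ?case by (simp only: pq_binom_hockey_stick)
qed

lemma chain_sum_power_weight:
  assumes "w \<le> k"
  shows "chain_sum (\<lambda>_. {..<k}) (\<lambda>_ w. r ^ w) (<) M m w = r ^ (m choose 2) * pq_binom r 1 w m"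
  using assms
proof (induction m arbitrary: w)
  case 0
  show ?case by (simp add: numeral_2_eq_2)
next
  case (Suc m)
  have "{b. b \<in> {..<k} \<and> b < w} = {..<w}" using Suc.prems by auto
  with Suc show ?case by (simp add: pq_binom_hockey_stick del: pq_binom.simps)
qed

lemma sris_poly_Suc:
  "sris_poly p q r x k (Suc n) = (\<Sum>m\<le>n. (x - 1) ^ m * sris_poly p q r x k (n - m) *
    (p ^ (Suc m choose 2) * pq_binom p q (Suc n) (Suc m) *
      (r ^ (Suc m choose 2) * pq_binom r 1 k (Suc m))))"
proof -
  have "chain_sum (wreath_letters k) (wreath_weight p q r) (rel_prod (<) (<))
        (n - m) (Suc m) (Suc n, k) =
      p ^ (Suc m choose 2) * pq_binom p q (Suc n) (Suc m) *
      (r ^ (Suc m choose 2) * pq_binom r 1 k (Suc m))" if "m \<le> n" for m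
    using that by (simp only: chain_sum_Times chain_sum_code_weight chain_sum_power_weight) simp
  then show ?thesis
    unfolding sris_poly_eq_word_sum
    by (subst word_sum_Suc_eq_sum_chain_sum [where a = "(Suc n, k)"])
      (auto simp del: chain_sum.simps)
qed

lemma sris_gf_nth: "fps_nth (sris_gf p q r x k) n = sris_poly p q r x k n / pq_fact p q n"
  by (simp add: sris_gf_def sris_poly_def)

lemma sris_gf_nth_Suc:
  assumes pq_nonzero: "\<And>n. pq_fact p q n \<noteq> 0" and "r_fact r k \<noteq> 0"
  shows "(x - 1) * fps_nth (sris_gf p q r x k) (Suc n) =
    (\<Sum>m\<le>n. fps_nth (sris_denom_sum p q r x k) (Suc m) * fps_nth (sris_gf p q r x k) (n - m))"
proof -
  let ?W = "sris_poly p q r x k" and ?F = "pq_fact p q"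
  let ?e = "\<lambda>m. p ^ (m choose 2) * r ^ (m choose 2) * r_binom r k m"
  have "(x - 1) * fps_nth (sris_gf p q r x k) (Suc n) =
      (\<Sum>m\<le>n. (x - 1) ^ Suc m * ?W (n - m) * ?e (Suc m) *
        (pq_binom p q (Suc n) (Suc m) / ?F (Suc n)))"
    unfolding sris_gf_nth sris_poly_Suc sum_divide_distrib sum_distrib_left
      r_binom_eq_pq_binom [OF assms(2)]
    by (simp add: mult_ac del: pq_binom.simps)
  also have "\<dots> = (\<Sum>m\<le>n. (x - 1) ^ Suc m * ?W (n - m) * ?e (Suc m) *
      (1 / (?F (Suc m) * ?F (n - m))))"
    by (intro sum.cong refl) (simp add: pq_binom_div_pq_fact [OF pq_nonzero] del: pq_binom.simps)
  also have "\<dots> =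
      (\<Sum>m\<le>n. fps_nth (sris_denom_sum p q r x k) (Suc m) * fps_nth (sris_gf p q r x k) (n - m))"
    by (simp add: sris_gf_nth sris_denom_sum_def mult_ac)
  finally show ?thesis .
qed

lemma fps_mult_nth_Suc:
  "fps_nth (f * g) (Suc n) =
    fps_nth f 0 * fps_nth g (Suc n) + (\<Sum>m\<le>n. fps_nth f (Suc m) * fps_nth g (n - m))"
  unfolding fps_mult_nth atLeast0AtMost by (subst sum.atMost_Suc_shift) simp

theorem sris_gf_eq:
  assumes "\<And>n. pq_fact p q n \<noteq> 0" and "r_fact r k \<noteq> 0" and "x \<noteq> 1"
  shows "sris_gf p q r x k =
    fps_const (1 - x) / (fps_const (1 - x) + sris_denom_sum p q r x k)"
proof -
  let ?D = "fps_const (1 - x) + sris_denom_sum p q r x k"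
  have D_0: "fps_nth ?D 0 = 1 - x" by (simp add: sris_denom_sum_def)
  have "?D * sris_gf p q r x k = fps_const (1 - x)"
  proof (rule fps_ext)
    fix n
    show "fps_nth (?D * sris_gf p q r x k) n = fps_nth (fps_const (1 - x)) n"
    proof (cases n)
      case 0
      then show ?thesis by (simp add: D_0 sris_gf_nth sris_poly_eq_word_sum sris_denom_sum_def)
    next
      case (Suc n')
      have "fps_nth (?D * sris_gf p q r x k) (Suc n') =
          (1 - x) * fps_nth (sris_gf p q r x k) (Suc n') +
          (x - 1) * fps_nth (sris_gf p q r x k) (Suc n')"
        unfolding sris_gf_nth_Suc [OF assms(1,2)] fps_mult_nth_Suc D_0 by simp
      then show ?thesis by (simp add: Suc algebra_simps)
    qed
  qed
  moreover have "?D \<noteq> 0"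
    using D_0 \<open>x \<noteq> 1\<close> by (metis eq_iff_diff_eq_0 fps_zero_nth)
  ultimately show ?thesis by (metis nonzero_mult_div_cancel_left)
qed

section \<open>The field of rational functions\<close>

definition eval_one :: "rat poly poly poly poly \<Rightarrow> rat" where
  "eval_one P = poly (poly (poly (poly P 1) 1) 1) 1"

lemma to_fract_power: "to_fract (a ^ n) = to_fract a ^ n"
  by (induction n) simp_all

lemma pq_fact_to_fract_nonzero:
  assumes "eval_one a = 1" and "eval_one b = 1"
  shows "pq_fact (to_fract a) (to_fract b) n \<noteq> 0"
proof -
  have "pq_num (to_fract a) (to_fract b) i \<noteq> 0" if "i > 0" for i
  proof -
    let ?N = "\<Sum>j<i. a ^ (i - 1 - j) * b ^ j"
    have "eval_one ?N = of_nat i"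
      using assms by (simp add: eval_one_def poly_sum)
    with that have "?N \<noteq> 0" by (auto simp: eval_one_def)
    then show ?thesis
      by (simp add: pq_num_def flip: to_fract_power to_fract_mult to_fract_sum)
  qed
  then show ?thesis by (simp add: pq_fact_def)
qed

lemma pq_fact_var_nonzero: "pq_fact var_p var_q n \<noteq> 0"
  unfolding var_p_def var_q_def to_fract_def [symmetric]
  by (rule pq_fact_to_fract_nonzero) (simp_all add: eval_one_def)

lemma r_fact_var_nonzero: "r_fact var_r n \<noteq> 0"
  unfolding var_r_def r_fact_eq_pq_fact to_fract_def [symmetric] to_fract_1 [symmetric]
  by (rule pq_fact_to_fract_nonzero) (simp_all add: eval_one_def)

lemma var_x_neq_one: "var_x \<noteq> 1"
  unfolding var_x_def to_fract_def [symmetric] to_fract_1 [symmetric] to_fract_eq_iff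
  by (simp add: one_pCons)

theorem theorem7:
  fixes k :: nat
  assumes "k \<ge> 2"
  shows "sris_gf var_p var_q var_r var_x k =
    fps_const (1 - var_x) / (fps_const (1 - var_x) + sris_denom_sum var_p var_q var_r var_x k)"
  by (intro sris_gf_eq pq_fact_var_nonzero r_fact_var_nonzero var_x_neq_one)

end
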